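(* Let $\mathbb{M}$ be the free groupoid (free magma) on one generator, let $N\subseteq\mathbb{M}$ be a non-empty subgroupoid, and let $G$ be the minimal generating set of $N$. Set $\lambda(N)=\min\{\ell(x)\mid x\in G\}$ and let $\mathrm{rk}(N)$ be the cardinality of $G$. If $\mathrm{rk}(N)<4^{\lambda(N)-1}$, then $N$ has null density, that is, $\delta(N:\mathbb{M})=0$.
   Context: A groupoid (magma) is a set with a binary operation, written $+$, with no axioms. $\mathbb{M}$ denotes the free groupoid on a single generator denoted $1$; its elements are $1, 1+1, 1+(1+1), (1+1)+1,\ldots$ (equivalently, finite planar binary trees). A subgroupoid is a subset closed under $+$. Each subgroupoid $N$ of $\mathbb{M}$ has a unique minimal generating set, and its cardinality is the rank $\mathrm{rk}(N)$. The length $\ell:\mathbb{M}\to\mathbb{N}$ is the unique function with $\ell(1)=1$ and $\ell(x+y)=\ell(x)+\ell(y)$. For $X\subseteq \mathbb{M}$, $|X|_n$ is the number of $x\in X$ with $\ell(x)=n$, and $|X|_{\leq n}=\sum_{k=1}^n |X|_k$. The density is $\delta(N:\mathbb{M})=\lim_{n\to\infty} |N|_{\leq n}/|\mathbb{M}|_{\leq n}$; "$N$ has null density" means that this limit exists and equals $0$. *)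

theory Defs
  imports Complex_Main "HOL-Library.Extended_Nat"
begin

datatype fm = One | Plus fm fm (infixl "\<oplus>" 65)

primrec len :: "fm \<Rightarrow> nat" where
  "len One = 1"
| "len (x \<oplus> y) = len x + len y"

definition subgroupoid :: "fm set \<Rightarrow> bool" where
  "subgroupoid N \<longleftrightarrow> (\<forall>x\<in>N. \<forall>y\<in>N. x \<oplus> y \<in> N)"

text \<open>\<open>subgroupoid hull X\<close> is the intersection of all subgroupoids containing \<open>X\<close>.
  Minimality is with respect to inclusion.\<close>

definition minimal_generating_set :: "fm set \<Rightarrow> fm set \<Rightarrow> bool" where
  "minimal_generating_set N G \<longleftrightarrow>
     subgroupoid hull G = N \<and> (\<forall>H. H \<subseteq> G \<and> subgroupoid hull H = N \<longrightarrow> H = G)"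

definition min_gens :: "fm set \<Rightarrow> fm set" where
  "min_gens N = (THE G. minimal_generating_set N G)"

text \<open>The rank is valued in the extended naturals because \<^const>\<open>card\<close> is \<open>0\<close> on infinite sets.\<close>

definition rk :: "fm set \<Rightarrow> enat" where
  "rk N = (if finite (min_gens N) then enat (card (min_gens N)) else \<infinity>)"

text \<open>On \<^typ>\<open>nat\<close> the infimum of a non-empty, possibly infinite set is its minimum.\<close>

definition min_len :: "fm set \<Rightarrow> nat" where
  "min_len N = (INF x\<in>min_gens N. len x)"

definition count_eq :: "fm set \<Rightarrow> nat \<Rightarrow> nat" where
  "count_eq X n = card {x \<in> X. len x = n}"

definition count_le :: "fm set \<Rightarrow> nat \<Rightarrow> nat" where
  "count_le X n = (\<Sum>k=1..n. count_eq X k)"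

definition has_density :: "fm set \<Rightarrow> real \<Rightarrow> bool" where
  "has_density N d \<longleftrightarrow> (\<lambda>n. real (count_le N n) / real (count_le UNIV n)) \<longlonglongrightarrow> d"

definition null_density :: "fm set \<Rightarrow> bool" where
  "null_density N \<longleftrightarrow> has_density N 0"

text \<open>The definitions above denote what is intended: the sets counted by \<^const>\<open>count_eq\<close> are finite, and
  every subgroupoid has exactly one minimal generating set.\<close>

lemma len_pos: "len x \<ge> 1"
  by (induction x) auto

lemma finite_len_le: "finite {x. len x \<le> n}"
proof (induction n)
  case 0
  have "{x. len x \<le> 0} = {}" using len_pos by (auto simp: Suc_le_eq)
  then show ?case by (metis finite.emptyI)
next
  case (Suc n)
  let ?S = "{x. len x \<le> n}"
  have "{x. len x \<le> Suc n} \<subseteq> insert One ((\<lambda>(x, y). x \<oplus> y) ` (?S \<times> ?S))"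
  proof
    fix z assume z: "z \<in> {x. len x \<le> Suc n}"
    show "z \<in> insert One ((\<lambda>(x, y). x \<oplus> y) ` (?S \<times> ?S))"
    proof (cases z)
      case (Plus x y)
      then have "x \<in> ?S" "y \<in> ?S" using z len_pos[of x] len_pos[of y] by auto
      then show ?thesis using Plus by force
    qed simp
  qed
  then show ?case using Suc by (meson finite_SigmaI finite_imageI finite_insert finite_subset)
qed

lemma finite_len_eq: "finite {x \<in> X. len x = n}"
  by (rule finite_subset[OF _ finite_len_le[of n]]) auto

lemma subgroupoid_Inter: "(\<And>S. S \<in> F \<Longrightarrow> subgroupoid S) \<Longrightarrow> subgroupoid (\<Inter>F)"
  by (auto simp: subgroupoid_def)

lemma subgroupoid_hull: "subgroupoid (subgroupoid hull X)"
  by (rule hull_in) (auto intro: subgroupoid_Inter)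

lemma hull_eq_imp_contains_indecomposables:
  assumes "subgroupoid hull H = N"
  shows "N - {x \<oplus> y | x y. x \<in> N \<and> y \<in> N} \<subseteq> H"
proof -
  let ?P = "{x \<oplus> y | x y. x \<in> N \<and> y \<in> N}"
  have N: "subgroupoid N" "H \<subseteq> N"
    using assms subgroupoid_hull[of H] hull_subset[of H subgroupoid] by auto
  have "subgroupoid (H \<union> ?P)"
    using N by (auto simp: subgroupoid_def)
  then have "subgroupoid hull H \<subseteq> H \<union> ?P"
    by (intro hull_minimal) auto
  then show ?thesis using assms by auto
qed

lemma hull_indecomposables:
  assumes "subgroupoid N"
  shows "subgroupoid hull (N - {x \<oplus> y | x y. x \<in> N \<and> y \<in> N}) = N"
    (is "subgroupoid hull ?I = N")
proof
  show "subgroupoid hull ?I \<subseteq> N"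
    using assms by (intro hull_minimal) auto
  have "z \<in> N \<Longrightarrow> z \<in> subgroupoid hull ?I" for z
  proof (induction z)
    case One
    then show ?case by (intro hull_inc) auto
  next
    case (Plus x y)
    show ?case
    proof (cases "x \<in> N \<and> y \<in> N")
      case True
      then have "x \<in> subgroupoid hull ?I" "y \<in> subgroupoid hull ?I" using Plus by blast+
      then show ?thesis using subgroupoid_hull[of ?I] unfolding subgroupoid_def[of "subgroupoid hull ?I"] by blast
    next
      case False
      then show ?thesis using Plus by (intro hull_inc) auto
    qed
  qed
  then show "N \<subseteq> subgroupoid hull ?I" by blast
qed

lemma minimal_generating_set_iff:
  assumes "subgroupoid N"
  shows "minimal_generating_set N G \<longleftrightarrow> G = N - {x \<oplus> y | x y. x \<in> N \<and> y \<in> N}"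
  using hull_eq_imp_contains_indecomposables[of _ N] hull_indecomposables[OF assms]
  unfolding minimal_generating_set_def by (metis (no_types, lifting) subset_antisym)

lemma ex1_minimal_generating_set:
  assumes "subgroupoid N"
  shows "\<exists>!G. minimal_generating_set N G"
  using minimal_generating_set_iff[OF assms] by simp

end

theory Submission
  imports Defs
begin

text \<open>
  Weight each \<open>t\<close> by \<open>x ^ len t\<close>. By the hypothesis on the rank, the weight of the generators is
  below \<open>1/4\<close> at \<open>x = 1/4\<close>, and hence still at most \<open>1/4\<close> at some \<open>x > 1/4\<close>. As every element of \<open>N\<close>
  is a generator or a sum of two shorter elements of \<open>N\<close>, the invariant \<open>s \<mapsto> 1/4 + s\<^sup>2\<close> with fixed
  point \<open>1/2\<close> bounds the weight of \<open>N\<close>, so that \<open>N\<close> has \<open>O(x\<^sup>-\<^sup>n)\<close> elements of length at most \<open>n\<close>.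
  For the whole free groupoid and \<open>y > 1/4\<close> the map \<open>s \<mapsto> y + s\<^sup>2\<close> has no fixed point, so the
  weight is infinite; supermultiplicativity of the counts turns this into a lower bound \<open>c y\<^sup>-\<^sup>n\<close> for
  the number of elements of length \<open>n\<close>. Taking \<open>1/4 < y < x\<close> gives density zero.
\<close>

section \<open>Weights and counts of sets of trees\<close>

text \<open>The generating function of \<open>A\<close> by length, evaluated at \<open>x\<close>. An
  infinite \<open>A\<close> gets the default value 0, so infinite sets are first cut off by
  \<open>upto_len\<close>.\<close>

definition weight :: "real \<Rightarrow> fm set \<Rightarrow> real" where
  "weight x A = (\<Sum>t\<in>A. x ^ len t)"

definition upto_len :: "fm set \<Rightarrow> nat \<Rightarrow> fm set" where
  "upto_len X n = {t \<in> X. len t \<le> n}"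

lemma finite_upto_len: "finite (upto_len X n)"
  unfolding upto_len_def by (rule finite_subset[OF _ finite_len_le[of n]]) auto

lemma inj_on_plus: "inj_on (\<lambda>(s, t). s \<oplus> t) P"
  by (auto simp: inj_on_def)

text \<open>A sum determines its two summands, and \<open>x ^ len t\<close> turns sums into
  products, so the double sum factors.\<close>

lemma weight_plus:
  "weight x ((\<lambda>(s, t). s \<oplus> t) ` (A \<times> B)) = weight x A * weight x B"
proof -
  have "weight x ((\<lambda>(s, t). s \<oplus> t) ` (A \<times> B)) = (\<Sum>(s, t)\<in>A \<times> B. x ^ len s * x ^ len t)"
    unfolding weight_def
    by (subst sum.reindex[OF inj_on_plus]) (auto intro!: sum.cong simp: power_add)
  also have "\<dots> = weight x A * weight x B"
    by (simp add: weight_def sum_product sum.cartesian_product)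
  finally show ?thesis .
qed

lemma weight_mono:
  assumes "finite B" "A \<subseteq> B" "x \<ge> 0"
  shows "weight x A \<le> weight x B"
  unfolding weight_def using assms by (intro sum_mono2) auto

lemma weight_Un_le:
  assumes "finite A" "finite B" "x \<ge> 0"
  shows "weight x (A \<union> B) \<le> weight x A + weight x B"
  using sum.union_inter[OF assms(1,2), of "\<lambda>t. x ^ len t"]
    sum_nonneg[of "A \<inter> B" "\<lambda>t. x ^ len t"] assms(3)
  unfolding weight_def by force

lemma weight_nonneg: "x \<ge> 0 \<Longrightarrow> weight x A \<ge> 0"
  by (simp add: weight_def sum_nonneg)

lemma weight_upto_len:
  "weight y (upto_len X n) = (\<Sum>k=1..n. real (count_eq X k) * y ^ k)"
proof -
  have "weight y (upto_len X n) = (\<Sum>k\<in>{1..n}. \<Sum>t\<in>{t \<in> upto_len X n. len t = k}. y ^ len t)"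
    unfolding weight_def
    using finite_upto_len len_pos
    by (intro sum.group[symmetric]) (auto simp: upto_len_def Suc_le_eq)
  also have "\<dots> = (\<Sum>k=1..n. real (count_eq X k) * y ^ k)"
  proof (rule sum.cong)
    fix k assume k: "k \<in> {1..n}"
    then have "{t \<in> upto_len X n. len t = k} = {t \<in> X. len t = k}"
      by (auto simp: upto_len_def)
    then show "(\<Sum>t\<in>{t \<in> upto_len X n. len t = k}. y ^ len t) = real (count_eq X k) * y ^ k"
      by (simp add: count_eq_def)
  qed simp
  finally show ?thesis .
qed

text \<open>For \<open>x\<close> at most 1, every element of length at most \<open>n\<close> has
  weight at least \<open>x ^ n\<close>.\<close>

lemma count_le_bound:
  assumes "0 \<le> x" "x \<le> 1"
  shows "real (count_le X n) * x ^ n \<le> weight x (upto_len X n)"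
proof -
  have "real (count_le X n) * x ^ n = (\<Sum>k=1..n. real (count_eq X k) * x ^ n)"
    by (simp add: count_le_def sum_distrib_right)
  also have "\<dots> \<le> (\<Sum>k=1..n. real (count_eq X k) * x ^ k)"
    using assms by (intro sum_mono mult_left_mono power_decreasing) auto
  finally show ?thesis by (simp add: weight_upto_len)
qed

section \<open>Upper bound for the subgroupoid\<close>

text \<open>Lengths are positive, so an element of length at most \<open>Suc n\<close> outside
  \<open>G\<close> has both summands in \<open>N\<close> of length at most \<open>n\<close>; this
  drives the induction.\<close>

lemma weight_subgroupoid_le:
  assumes gens: "\<And>s t. s \<oplus> t \<in> N - G \<Longrightarrow> s \<in> N \<and> t \<in> N" and "One \<in> N \<Longrightarrow> One \<in> G"
    and G: "finite G" "x \<ge> 0" "weight x G \<le> 1/4"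
  shows "weight x (upto_len N n) \<le> 1/2"
proof (induction n)
  case 0
  have "upto_len N 0 = {}"
    using len_pos by (auto simp: upto_len_def Suc_le_eq)
  then show ?case by (simp add: weight_def)
next
  case (Suc n)
  let ?U = "upto_len N n" and ?P = "\<lambda>(s, t). s \<oplus> t"
  have "upto_len N (Suc n) \<subseteq> G \<union> ?P ` (?U \<times> ?U)"
  proof
    fix z assume z: "z \<in> upto_len N (Suc n)"
    show "z \<in> G \<union> ?P ` (?U \<times> ?U)"
    proof (cases z)
      case One
      then show ?thesis using assms(2) z by (auto simp: upto_len_def)
    next
      case (Plus s t)
      show ?thesis
      proof (cases "z \<in> G")
        case False
        then have "s \<in> N" "t \<in> N" using gens[of s t] z Plus by (auto simp: upto_len_def)
        moreover have "len s \<le> n" "len t \<le> n"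
          using z Plus len_pos[of s] len_pos[of t] by (auto simp: upto_len_def)
        ultimately show ?thesis using Plus by (force simp: upto_len_def)
      qed simp
    qed
  qed
  then have "weight x (upto_len N (Suc n)) \<le> weight x (G \<union> ?P ` (?U \<times> ?U))"
    using G by (intro weight_mono) (auto simp: finite_upto_len)
  also have "\<dots> \<le> weight x G + weight x (?P ` (?U \<times> ?U))"
    using G by (intro weight_Un_le) (auto simp: finite_upto_len)
  also have "\<dots> \<le> 1/4 + 1/2 * (1/2)"
    unfolding weight_plus using G Suc
    by (intro add_mono mult_mono weight_nonneg) auto
  finally show ?case by simp
qed

section \<open>Lower bound for the free groupoid\<close>

text \<open>Two trees of length at most \<open>n\<close> have a sum of length at most
  \<open>2 * n\<close>, and \<open>One\<close>, of weight \<open>y\<close>, is not a sum.\<close>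

lemma weight_UNIV_double:
  assumes "y \<ge> 0" "n \<ge> 1"
  shows "weight y (upto_len UNIV (2 * n)) \<ge> y + (weight y (upto_len UNIV n))\<^sup>2"
proof -
  let ?U = "upto_len UNIV n" and ?P = "\<lambda>(s, t). s \<oplus> t"
  have "One \<notin> ?P ` (?U \<times> ?U)" by auto
  then have "y + weight y (?P ` (?U \<times> ?U)) = weight y (insert One (?P ` (?U \<times> ?U)))"
    by (simp add: weight_def finite_upto_len)
  also have "\<dots> \<le> weight y (upto_len UNIV (2 * n))"
    using assms by (intro weight_mono finite_upto_len) (auto simp: upto_len_def)
  finally show ?thesis by (simp add: weight_plus power2_eq_square)
qed

lemma weight_UNIV_unbounded:
  assumes "y > 1/4"
  shows "\<exists>n. weight y (upto_len UNIV n) > B"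
proof -
  have ge: "weight y (upto_len UNIV (2 ^ j)) \<ge> real j * (y - 1/4)" for j
  proof (induction j)
    case 0
    then show ?case using assms by (simp add: weight_nonneg)
  next
    case (Suc j)
    let ?w = "weight y (upto_len UNIV (2 ^ j))"
    \<comment> \<open>Since \<open>y + ?w\<^sup>2 - ?w = (?w - 1/2)\<^sup>2 + (y - 1/4)\<close>,
      each doubling of the length bound adds at least \<open>y - 1/4\<close>.\<close>
    have "(?w - 1/2)\<^sup>2 \<ge> 0" by simp
    then have "?w + (y - 1/4) \<le> y + ?w\<^sup>2" by (simp add: power2_eq_square algebra_simps)
    also have "\<dots> \<le> weight y (upto_len UNIV (2 ^ Suc j))"
      using weight_UNIV_double[of y "2 ^ j"] assms by simp
    finally show ?case using Suc by (simp add: algebra_simps add_divide_distrib)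
  qed
  obtain j where "real j * (y - 1/4) > B"
    using ex_less_of_nat_mult[of "y - 1/4" B] assms by auto
  then show ?thesis using ge[of j] by (meson less_le_trans)
qed

lemma count_eq_UNIV_supermult:
  "count_eq UNIV m * count_eq UNIV n \<le> count_eq UNIV (m + n)"
proof -
  let ?L = "\<lambda>k. {t \<in> UNIV. len t = k}" and ?P = "\<lambda>(s, t). s \<oplus> t"
  have "card (?L m) * card (?L n) = card (?P ` (?L m \<times> ?L n))"
    by (subst card_image[OF inj_on_plus]) (rule card_cartesian_product[symmetric])
  also have "\<dots> \<le> card (?L (m + n))"
    by (intro card_mono finite_len_eq) auto
  finally show ?thesis by (simp only: count_eq_def)
qed

lemma count_eq_UNIV_pos:
  assumes "n \<ge> 1"
  shows "count_eq UNIV n > 0"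
proof -
  have one: "count_eq UNIV 1 > 0"
    using finite_len_eq[of UNIV 1] by (auto simp: count_eq_def card_gt_0_iff intro: exI[of _ One])
  from assms show ?thesis
  proof (induction n rule: dec_induct)
    case base
    show ?case by (rule one)
  next
    case (step n)
    then have "0 < count_eq UNIV n * count_eq UNIV 1" using one by simp
    also have "\<dots> \<le> count_eq UNIV (Suc n)"
      using count_eq_UNIV_supermult[of n 1] by simp
    finally show ?case .
  qed
qed

text \<open>If all these terms were below 1, a geometric series of ratio \<open>z / y\<close> would
  bound the weight at some \<open>z\<close> between 1/4 and \<open>y\<close>, where it is
  unbounded.\<close>

lemma count_eq_UNIV_large:
  assumes "y > 1/4"
  shows "\<exists>k\<ge>1. real (count_eq UNIV k) * y ^ k \<ge> 1"
proof (rule ccontr)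
  assume none: "\<not> ?thesis"
  have less: "real (count_eq UNIV k) * y ^ k < 1" if "k \<ge> 1" for k
    using none that by (meson not_le)
  obtain z where z: "1/4 < z" "z < y" using dense assms by blast
  define q where "q = z / y"
  have q: "0 \<le> q" "q < 1" using z by (auto simp: q_def)
  have "weight z (upto_len UNIV n) \<le> 1 / (1 - q)" for n
  proof -
    have "weight z (upto_len UNIV n) = (\<Sum>k=1..n. (real (count_eq UNIV k) * y ^ k) * q ^ k)"
      using z by (simp add: weight_upto_len q_def power_divide)
    also have "\<dots> \<le> (\<Sum>k=1..n. q ^ k)"
    proof (rule sum_mono)
      fix k assume "k \<in> {1..n}"
      then show "real (count_eq UNIV k) * y ^ k * q ^ k \<le> q ^ k"
        using less[of k] q by (intro mult_left_le_one_le) (use z in auto)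
    qed
    also have "\<dots> \<le> (\<Sum>k. q ^ k)"
      using q by (intro sum_le_suminf summable_geometric) auto
    also have "\<dots> = 1 / (1 - q)" using q by (simp add: suminf_geometric)
    finally show ?thesis .
  qed
  then show False using weight_UNIV_unbounded[OF z(1), of "1 / (1 - q)"] by (meson not_le)
qed

lemma count_eq_UNIV_lower:
  assumes "y > 1/4"
  shows "\<exists>c>0. \<forall>n\<ge>1. real (count_eq UNIV n) * y ^ n \<ge> c"
proof -
  define e where "e n = real (count_eq UNIV n) * y ^ n" for n
  have e_pos: "e n > 0" if "n \<ge> 1" for n
    using count_eq_UNIV_pos[OF that] assms by (simp add: e_def)
  have e_mult: "e m * e n \<le> e (m + n)" for m n
  proof -
    have "real (count_eq UNIV m * count_eq UNIV n) * y ^ (m + n)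
            \<le> real (count_eq UNIV (m + n)) * y ^ (m + n)"
      using assms count_eq_UNIV_supermult by (intro mult_right_mono of_nat_mono) auto
    then show ?thesis by (simp add: e_def power_add mult_ac)
  qed
  obtain k where k: "k \<ge> 1" "e k \<ge> 1"
    using count_eq_UNIV_large[OF assms] by (auto simp: e_def)
  \<comment> \<open>As \<open>e k\<close> is at least 1, supermultiplicativity gives
    \<open>e (n - k) \<le> e n\<close> for \<open>n > k\<close>. Descending in steps of
    \<open>k\<close> ends in \<open>{1..k}\<close>, where the minimum is positive.\<close>
  define c where "c = Min (e ` {1..k})"
  have "c > 0" using k e_pos by (auto simp: c_def)
  moreover have "e n \<ge> c" if "n \<ge> 1" for n
    using that
  proof (induction n rule: less_induct)
    case (less n)
    show ?case
    proof (cases "n \<le> k")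
      case True
      then show ?thesis using less.prems by (auto simp: c_def)
    next
      case False
      have "c \<le> e (n - k)" using less.IH[of "n - k"] False k by simp
      also have "\<dots> \<le> e (n - k) * e k"
        using e_pos[of "n - k"] False k by simp
      also have "\<dots> \<le> e n" using e_mult[of "n - k" k] False by simp
      finally show ?thesis .
    qed
  qed
  ultimately show ?thesis unfolding e_def by blast
qed

section \<open>Weight of the generators\<close>

text \<open>As a function of \<open>x\<close>, the weight is a polynomial (constantly 0 for infinite
  \<open>G\<close>), so by continuity the strict bound persists just to the right of
  \<open>a\<close>.\<close>

lemma weight_extend_right:
  assumes "weight a G < b" "a < 1"
  shows "\<exists>x. a < x \<and> x < 1 \<and> weight x G < b"
proof -
  have "((\<lambda>x. weight x G) \<longlongrightarrow> weight a G) (at_right a)"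
    unfolding weight_def by (intro tendsto_intros)
  then have "\<forall>\<^sub>F x in at_right a. weight x G < b"
    using assms(1) by (rule order_tendstoD(2))
  moreover have "\<forall>\<^sub>F x in at_right a. x \<in> {a<..<1}"
    using assms(2) by (rule eventually_at_right_real)
  ultimately have "\<forall>\<^sub>F x in at_right a. a < x \<and> x < 1 \<and> weight x G < b"
    by eventually_elim auto
  then show ?thesis
    using eventually_happens'[OF trivial_limit_at_right_real] by blast
qed

lemma rk_less_imp:
  assumes "rk N < 4 ^ k"
  shows "finite (min_gens N)" "card (min_gens N) < 4 ^ k"
proof -
  have pow: "(4::enat) ^ k = enat (4 ^ k)"
    by (induction k) (auto simp: one_enat_def numeral_eq_enat)
  show "finite (min_gens N)" using assms by (auto simp: rk_def split: if_splits)
  then show "card (min_gens N) < 4 ^ k" using assms by (simp add: rk_def pow)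
qed

text \<open>There are fewer than \<open>4 ^ (?l - 1)\<close> generators, each of weight at most
  \<open>(1/4) ^ ?l\<close>.\<close>

lemma weight_min_gens_less:
  assumes "rk N < 4 ^ (min_len N - 1)"
  shows "weight (1/4) (min_gens N) < 1/4"
proof -
  let ?G = "min_gens N" and ?l = "min_len N"
  note card = rk_less_imp[OF assms]
  have len_ge: "?l \<le> len g" if "g \<in> ?G" for g
    unfolding min_len_def using that by (intro cINF_lower) auto
  show ?thesis
  proof (cases "?l = 0")
    \<comment> \<open>Truncated subtraction makes the rank bound \<open>4 ^ 0\<close>, so there are
      no generators and the weight is an empty sum.\<close>
    case True
    then show ?thesis using card by (simp add: weight_def)
  next
    case False
    have "weight (1/4) ?G \<le> (\<Sum>g\<in>?G. (1/4) ^ ?l)"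
      unfolding weight_def by (intro sum_mono power_decreasing len_ge) auto
    also have "\<dots> = real (card ?G) * (1/4) ^ ?l" by simp
    also have "\<dots> < real (4 ^ (?l - 1)) * (1/4) ^ ?l"
      using card(2) by (intro mult_strict_right_mono) (simp_all only: of_nat_less_iff, simp)
    also have "\<dots> = 1/4"
      using False by (cases ?l) (simp_all add: power_divide)
    finally show ?thesis .
  qed
qed

theorem theorem3p1:
  fixes N :: "fm set"
  assumes "subgroupoid N" and "N \<noteq> {}"
    and "rk N < 4 ^ (min_len N - 1)"
  shows "null_density N"
proof -
  let ?G = "min_gens N"
  have G: "?G = N - {s \<oplus> t | s t. s \<in> N \<and> t \<in> N}"
    unfolding min_gens_def minimal_generating_set_iff[OF assms(1)] by simp
  obtain x where x: "1/4 < x" "x < 1" "weight x ?G < 1/4"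
    using weight_extend_right[OF weight_min_gens_less[OF assms(3)]] by auto
  have weight_N: "weight x (upto_len N n) \<le> 1/2" for n
    using x rk_less_imp(1)[OF assms(3)] by (intro weight_subgroupoid_le[of N ?G]) (auto simp: G)
  obtain y where y: "1/4 < y" "y < x" using dense x(1) by blast
  obtain c where c: "c > 0" "\<And>n. n \<ge> 1 \<Longrightarrow> real (count_eq UNIV n) * y ^ n \<ge> c"
    using count_eq_UNIV_lower[OF y(1)] by blast
  \<comment> \<open>The numerator is at most \<open>1 / (2 * x ^ n)\<close>. The denominator is at
    least \<open>c / y ^ n\<close>, already by the trees of length exactly \<open>n\<close>.\<close>
  have bound: "real (count_le N n) / real (count_le UNIV n) \<le> (1 / (2 * c)) * (y / x) ^ n"
    if "n \<ge> 1" for n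
  proof -
    have "real (count_le N n) * x ^ n \<le> 1/2"
      using count_le_bound[of x N n] weight_N[of n] x by simp
    then have upper: "real (count_le N n) \<le> 1 / (2 * x ^ n)"
      using x by (simp add: field_simps)
    have "count_eq UNIV n \<le> count_le UNIV n"
      unfolding count_le_def using that by (intro member_le_sum) auto
    then have "real (count_eq UNIV n) * y ^ n \<le> real (count_le UNIV n) * y ^ n"
      using y by (intro mult_right_mono) auto
    then have "c \<le> real (count_le UNIV n) * y ^ n"
      using c(2)[OF that] by linarith
    then have lower: "c / y ^ n \<le> real (count_le UNIV n)"
      using y by (simp add: field_simps)
    have "real (count_le N n) / real (count_le UNIV n) \<le> (1 / (2 * x ^ n)) / (c / y ^ n)"
      using upper lower c(1) x y by (intro frac_le) auto
    then show ?thesis by (simp add: power_divide mult_ac)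
  qed
  have "(\<lambda>n. (1 / (2 * c)) * (y / x) ^ n) \<longlonglongrightarrow> (1 / (2 * c)) * 0"
    using x y by (intro tendsto_mult tendsto_const LIMSEQ_power_zero) auto
  then have limit: "(\<lambda>n. (1 / (2 * c)) * (y / x) ^ n) \<longlonglongrightarrow> 0" by simp
  have "(\<lambda>n. real (count_le N n) / real (count_le UNIV n)) \<longlonglongrightarrow> 0"
  proof (rule tendsto_sandwich[OF _ _ tendsto_const limit])
    show "\<forall>\<^sub>F n in sequentially. real (count_le N n) / real (count_le UNIV n)
            \<le> (1 / (2 * c)) * (y / x) ^ n"
      using eventually_ge_at_top[of 1] by (rule eventually_mono) (rule bound)
  qed simp
  then show ?thesis by (simp add: null_density_def has_density_def)
qed

end
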